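(* Let $A$ be a partially ordered set that is iteratively algebraic, i.e. $K^n(A)$ is algebraic for every natural number $n$. Then $A = K(A)$, i.e. every element of $A$ is compact.
   Context: A subset $X$ of a partially ordered set $L$ is directed if every finite subset of $X$ (including the empty subset) has an upper bound in $X$; in particular directed sets are nonempty. $L$ is upwards complete if every directed $X \subseteq L$ has a supremum $\bigvee X$ in $L$. For $X\subseteq L$, $(X] = \{y \in L \mid y \le x \text{ for some } x \in X\}$, and $(x] = (\{x\}]$. An element $k \in L$ is compact if for every directed $X \subseteq L$ that has a supremum in $L$, $k \le \bigvee X$ implies $k \le x$ for some $x \in X$. $K(L)$ denotes the set of compact elements of $L$ with the induced order. $L$ is algebraic if it is upwards complete and for every $x \in L$ the set $(x] \cap K(L)$ is directed and has supremum $x$ in $L$. Define $K^0(L) = L$ and $K^{n+1}(L) = K(K^n(L))$, each with the induced order; compactness in $K^{n+1}(L)$ is taken with respect to the order of $K^n(L)$ and suprema computed in $K^n(L)$. *)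

theory Defs
  imports Main "HOL-Library.Lub_Glb"
begin

text \<open>
  A partially ordered set is a carrier set over a type of class \<open>order\<close>, with the induced order.
  Thus \<open>isLub L X s\<close> says that \<open>s\<close> is the supremum of \<open>X\<close> computed in \<open>L\<close>; it may differ from the
  supremum of \<open>X\<close> computed in a larger or smaller carrier.
\<close>

text \<open>The case \<open>F = {}\<close> makes directed sets nonempty.\<close>

definition directed :: "'a::order set \<Rightarrow> bool" where
  "directed X \<longleftrightarrow> (\<forall>F. finite F \<and> F \<subseteq> X \<longrightarrow> (\<exists>u. isUb X F u))"

definition upwards_complete :: "'a::order set \<Rightarrow> bool" where
  "upwards_complete L \<longleftrightarrow> (\<forall>X. X \<subseteq> L \<and> directed X \<longrightarrow> (\<exists>s. isLub L X s))"

definition down_closure :: "'a::order set \<Rightarrow> 'a set \<Rightarrow> 'a set" where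
  "down_closure L X = {y \<in> L. \<exists>x\<in>X. y \<le> x}"

definition compact_element :: "'a::order set \<Rightarrow> 'a \<Rightarrow> bool" where
  "compact_element L k \<longleftrightarrow> k \<in> L \<and>
     (\<forall>X s. X \<subseteq> L \<and> directed X \<and> isLub L X s \<and> k \<le> s \<longrightarrow> (\<exists>x\<in>X. k \<le> x))"

definition compacts :: "'a::order set \<Rightarrow> 'a set" where
  "compacts L = {k. compact_element L k}"

definition algebraic_poset :: "'a::order set \<Rightarrow> bool" where
  "algebraic_poset L \<longleftrightarrow> upwards_complete L \<and>
     (\<forall>x\<in>L. directed (down_closure L {x} \<inter> compacts L) \<and>
            isLub L (down_closure L {x} \<inter> compacts L) x)"

definition iteratively_algebraic :: "'a::order set \<Rightarrow> bool" where
  "iteratively_algebraic L \<longleftrightarrow> (\<forall>n. algebraic_poset ((compacts ^^ n) L))"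

end

theory Submission imports Defs begin

text \<open>
  Suppose \<open>x \<in> A\<close> is not compact. The supremum in \<open>K(A)\<close> of \<open>(x] \<inter> K(A)\<close> lies above \<open>x\<close> and is not
  compact in \<open>K(A)\<close>; iterating gives an increasing sequence \<open>s\<close> with \<open>s n \<in> K\<^sup>n(A) - K\<^sup>n\<^sup>+\<^sup>1(A)\<close>.
  Order such sequences by \<open>s < t\<close> iff \<open>s n < t n\<close> for all \<open>n\<close>. A chain without a greatest
  element has an upper bound, obtained by taking suprema in each \<open>K\<^sup>n(A)\<close>, because the supremum of a
  directed set without greatest element is not compact. By Zorn's lemma there is a maximal sequence
  \<open>s\<close>. But \<open>t n = sup {s m | m \<ge> n}\<close>, computed in \<open>K\<^sup>n(A)\<close>, is a strictly larger one.
\<close>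

lemma isLub_iff:
  "isLub L X s \<longleftrightarrow> s \<in> L \<and> (\<forall>x\<in>X. x \<le> s) \<and> (\<forall>u\<in>L. (\<forall>x\<in>X. x \<le> u) \<longrightarrow> s \<le> u)"
  by (auto simp: isLub_def leastP_def isUb_def setle_def setge_def)

lemma directed_chain:
  assumes "X \<noteq> {}" and chain: "\<And>x y. x \<in> X \<Longrightarrow> y \<in> X \<Longrightarrow> x \<le> y \<or> y \<le> x"
  shows "directed X"
proof -
  have "\<exists>u\<in>X. \<forall>x\<in>F. x \<le> u" if "finite F" "F \<subseteq> X" for F
    using that
  proof (induction F rule: finite_induct)
    case empty
    then show ?case using assms(1) by blast
  next
    case (insert a F)
    then obtain u where "u \<in> X" "\<forall>x\<in>F. x \<le> u" by blast
    moreover have "a \<le> u \<or> u \<le> a" using chain insert.prems \<open>u \<in> X\<close> by blast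
    ultimately have "\<forall>x\<in>insert a F. x \<le> (if a \<le> u then u else a)"
      by (auto intro: order.trans)
    moreover have "(if a \<le> u then u else a) \<in> X" using insert.prems \<open>u \<in> X\<close> by simp
    ultimately show ?case by blast
  qed
  then show ?thesis unfolding directed_def isUb_def setle_def by blast
qed

lemma compacts_subset: "compacts L \<subseteq> L"
  by (auto simp: compacts_def compact_element_def)

text \<open>Compactness of \<open>s\<close>, applied to \<open>X\<close> itself, would put
  \<open>s\<close> below a member of \<open>X\<close>, which would then be a greatest
  element.\<close>

lemma isLub_not_compact:
  assumes "X \<subseteq> L" "directed X" "isLub L X s" and no_max: "\<And>x. x \<in> X \<Longrightarrow> \<exists>y\<in>X. x < y"
  shows "s \<notin> compacts L"
proof
  assume "s \<in> compacts L"
  then obtain x where "x \<in> X" "s \<le> x"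
    using assms(1-3) unfolding compacts_def compact_element_def by blast
  then show False
    using no_max assms(3) unfolding isLub_iff by (meson leD order.trans)
qed

text \<open>Supplies the terms of both sequences of suprema in the main proof: over a chain of
  sequences, coordinate by coordinate, and over the tails of a single sequence.\<close>

lemma ex_noncompact_isLub_chain:
  assumes "upwards_complete L" "X \<subseteq> L" "X \<noteq> {}"
    and "\<And>x y. x \<in> X \<Longrightarrow> y \<in> X \<Longrightarrow> x \<le> y \<or> y \<le> x"
    and "\<And>x. x \<in> X \<Longrightarrow> \<exists>y\<in>X. x < y"
  shows "\<exists>s\<in>L - compacts L. isLub L X s"
proof -
  have "directed X" using assms(3,4) by (rule directed_chain)
  then obtain s where "isLub L X s" using assms(1,2) unfolding upwards_complete_def by blast
  moreover have "s \<notin> compacts L" using isLub_not_compact assms(2,5) \<open>directed X\<close> calculation by blast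
  ultimately show ?thesis unfolding isLub_iff by blast
qed

text \<open>Take \<open>y\<close> to be the supremum in \<open>compacts L\<close> of the compact
  elements below \<open>x\<close>. As \<open>x\<close> is their supremum in the larger
  \<open>L\<close>, \<open>x \<le> y\<close>. Compactness of \<open>y\<close> in
  \<open>compacts L\<close> would put \<open>y\<close> below one of them, forcing
  \<open>y = x\<close>, although \<open>x\<close> is not compact in \<open>L\<close>.\<close>

lemma ex_noncompact_above:
  assumes "algebraic_poset L" "upwards_complete (compacts L)" "x \<in> L - compacts L"
  shows "\<exists>y \<in> compacts L - compacts (compacts L). x \<le> y"
proof -
  let ?D = "down_closure L {x} \<inter> compacts L"
  have D: "directed ?D" "isLub L ?D x"
    using assms(1,3) by (auto simp: algebraic_poset_def)
  then obtain y where y: "isLub (compacts L) ?D y"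
    using assms(2) unfolding upwards_complete_def by blast
  then have "x \<le> y"
    using D(2) compacts_subset[of L] unfolding isLub_iff by blast
  moreover have "y \<notin> compacts (compacts L)"
  proof
    assume "y \<in> compacts (compacts L)"
    then obtain d where "d \<in> ?D" "y \<le> d"
      using D(1) y unfolding compacts_def[of "compacts L"] compact_element_def[of "compacts L"]
      by blast
    then have "y \<le> x" unfolding down_closure_def by (auto intro: order.trans)
    then show False using \<open>x \<le> y\<close> y assms(3) unfolding isLub_iff by auto
  qed
  ultimately show ?thesis using y unfolding isLub_iff by blast
qed

theorem mainTheorem1:
  fixes A :: "'a::order set"
  assumes "iteratively_algebraic A"
  shows "A = compacts A"
proof (rule ccontr)
  define K where "K n = (compacts ^^ n) A" for n
  have alg: "algebraic_poset (K n)" for n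
    using assms by (simp add: iteratively_algebraic_def K_def)
  then have uc: "upwards_complete (K n)" for n
    by (simp add: algebraic_poset_def)
  have K_Suc: "K (Suc n) = compacts (K n)" for n
    by (simp add: K_def)
  have K_mono: "K m \<subseteq> K n" if "n \<le> m" for n m
    using that by (rule lift_Suc_antimono_le[rotated]) (simp add: K_Suc compacts_subset)
  define S where "S = {s. \<forall>n. s n \<in> K n - K (Suc n) \<and> s n \<le> s (Suc n)}"
  \<comment> \<open>Strictness in every coordinate ensures that for a chain without greatest element
    no coordinate attains a greatest value.\<close>
  define R where "R s t \<longleftrightarrow> s = t \<or> (\<forall>n. s n < t n)" for s t :: "nat \<Rightarrow> 'a"

  assume "A \<noteq> compacts A"
  then obtain a where "a \<in> K 0 - K (Suc 0)"
    using compacts_subset[of A] by (auto simp: K_def)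
  moreover have "\<exists>y\<in>K (Suc n) - K (Suc (Suc n)). x \<le> y" if "x \<in> K n - K (Suc n)" for n x
    using ex_noncompact_above[OF alg] uc[of "Suc n"] that by (simp add: K_Suc)
  ultimately have "\<exists>s. \<forall>n. s n \<in> K n - K (Suc n) \<and> s n \<le> s (Suc n)"
    by (intro dependent_nat_choice) blast+
  then obtain s0 where s0: "s0 \<in> S" by (auto simp: S_def)

  \<comment> \<open>By cofinality, \<open>t (Suc n)\<close> bounds \<open>X n\<close>, and it lies
    in \<open>K n\<close> because \<open>K\<close> is decreasing; hence it is above the supremum
    \<open>t n\<close> taken in \<open>K n\<close>.\<close>
  have sup_in_S: "t \<in> S"
    if t: "\<And>n. t n \<in> K n - K (Suc n) \<and> isLub (K n) (X n) (t n)"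
      and X: "\<And>n x. x \<in> X n \<Longrightarrow> \<exists>y\<in>X (Suc n). x \<le> y" for t X
  proof -
    have "t n \<le> t (Suc n)" for n
    proof -
      have "t (Suc n) \<in> K n" using t[of "Suc n"] K_mono[of n "Suc n"] by auto
      moreover have "x \<le> t (Suc n)" if "x \<in> X n" for x
        using X[OF that] t[of "Suc n"] unfolding isLub_iff by (meson order.trans)
      ultimately show ?thesis using t[of n] unfolding isLub_iff by blast
    qed
    then show ?thesis using t by (auto simp: S_def)
  qed

  have "\<exists>s\<in>S. \<forall>t\<in>S. R s t \<longrightarrow> t = s"
  proof (rule predicate_Zorn)
    show "partial_order_on S (relation_of R S)"
    proof (rule partial_order_on_relation_ofI)
      show "R s u" if "R s t" "R t u" for s t u
        using that unfolding R_def by (meson less_trans)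
      show "s = t" if "R s t" "R t s" for s t
        using that unfolding R_def by (meson less_asym)
    qed (simp add: R_def)
  next
    fix C assume "C \<in> Chains (relation_of R S)"
    then have CS: "C \<subseteq> S" and chain: "\<And>s t. s \<in> C \<Longrightarrow> t \<in> C \<Longrightarrow> R s t \<or> R t s"
      by (auto simp: Chains_def relation_of_def)
    show "\<exists>u\<in>S. \<forall>s\<in>C. R s u"
    proof (cases "C = {} \<or> (\<exists>u\<in>C. \<forall>s\<in>C. R s u)")
      case True
      then show ?thesis using s0 CS by blast
    next
      case False
      \<comment> \<open>Some \<open>d\<close> in \<open>C\<close> fails \<open>R d c\<close>;
        comparability gives \<open>R c d\<close>, and \<open>d \<noteq> c\<close> by
        reflexivity.\<close>
      then have ex_above: "\<exists>d\<in>C. \<forall>n. c n < d n" if "c \<in> C" for c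
        using chain that unfolding R_def by metis
      have "\<exists>x \<in> K n - K (Suc n). isLub (K n) ((\<lambda>s. s n) ` C) x" for n
        unfolding K_Suc
      proof (rule ex_noncompact_isLub_chain[OF uc])
        show "(\<lambda>s. s n) ` C \<subseteq> K n" using CS by (auto simp: S_def)
        show "(\<lambda>s. s n) ` C \<noteq> {}" using False by auto
        show "x \<le> y \<or> y \<le> x" if "x \<in> (\<lambda>s. s n) ` C" "y \<in> (\<lambda>s. s n) ` C" for x y
          using that chain unfolding R_def by (force simp: less_imp_le)
        show "\<exists>y\<in>(\<lambda>s. s n) ` C. x < y" if "x \<in> (\<lambda>s. s n) ` C" for x
          using that ex_above by blast
      qed
      then obtain t where t: "\<And>n. t n \<in> K n - K (Suc n) \<and> isLub (K n) ((\<lambda>s. s n) ` C) (t n)"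
        by metis
      have "t \<in> S"
        using t by (rule sup_in_S) (use CS in \<open>auto simp: S_def\<close>)
      moreover have "c n < t n" if "c \<in> C" for c n
        using ex_above[OF that] t[of n] unfolding isLub_iff by (auto intro: less_le_trans)
      ultimately show ?thesis by (auto simp: R_def)
    qed
  qed
  then obtain s where s: "s \<in> S" and maximal: "\<And>t. t \<in> S \<Longrightarrow> R s t \<Longrightarrow> t = s" by blast

  have mono: "s m \<le> s n" if "m \<le> n" for m n
    using s that by (auto simp: S_def intro: lift_Suc_mono_le)
  \<comment> \<open>Equality is impossible: \<open>s (Suc n)\<close> lies in
    \<open>K (Suc n)\<close>, \<open>s n\<close> does not.\<close>
  have less_Suc: "s n < s (Suc n)" for n
    using s by (auto simp: S_def order.strict_iff_order) metis
  \<comment> \<open>The tail starts at \<open>n\<close> because the earlier terms lie outside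
    \<open>K n\<close>. It has no greatest element since \<open>s\<close> is strictly
    increasing.\<close>
  have "\<exists>x \<in> K n - K (Suc n). isLub (K n) (s ` {n..}) x" for n
    unfolding K_Suc
  proof (rule ex_noncompact_isLub_chain[OF uc])
    show "s ` {n..} \<subseteq> K n" using s K_mono by (fastforce simp: S_def)
    show "s ` {n..} \<noteq> {}" by simp
    show "x \<le> y \<or> y \<le> x" if "x \<in> s ` {n..}" "y \<in> s ` {n..}" for x y
      using that mono nle_le by (metis imageE)
    show "\<exists>y\<in>s ` {n..}. x < y" if "x \<in> s ` {n..}" for x
      using that less_Suc by (auto intro: le_SucI)
  qed
  then obtain t where t: "\<And>n. t n \<in> K n - K (Suc n) \<and> isLub (K n) (s ` {n..}) (t n)"
    by metis
  have "t \<in> S"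
    using t
  proof (rule sup_in_S)
    show "\<exists>y\<in>s ` {Suc n..}. x \<le> y" if "x \<in> s ` {n..}" for n x
    proof -
      \<comment> \<open>The witness is \<open>s (Suc m)\<close>, since for \<open>m = n\<close> the
        term \<open>s m\<close> is missing from the next tail.\<close>
      obtain m where "n \<le> m" "x = s m" using \<open>x \<in> s ` {n..}\<close> by auto
      then show ?thesis using less_Suc[of m] by (intro bexI[of _ "s (Suc m)"]) auto
    qed
  qed
  moreover have less: "s n < t n" for n
  proof -
    have "s (Suc n) \<le> t n" using t[of n] unfolding isLub_iff by auto
    then show ?thesis using less_Suc[of n] by (rule less_le_trans[rotated])
  qed
  ultimately have "t = s" using maximal by (auto simp: R_def)
  then show False using less by auto
qed

end
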